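(* Let $\delta_2,\ldots,\delta_n$ be independent zero-mean random variables with $|\delta_k|\le u$, let $h$ be the height of the computational tree for general summation of the real numbers $x_1,\ldots,x_n$, let $\delta\in(0,1)$ and $\eta\in(0,1)$, and let $\lambda\equiv\sqrt{2\ln(2n/\eta)}$. Then with probability at least $1-(\delta+\eta)$, the error in general summation is bounded by $$|\hat{s}_n-s_n|\le u\,\exp(\lambda\sqrt{h}\,u)\left(\sum_{k=2}^n s_k^2\right)^{1/2}\sqrt{2\ln(2/\delta)}.$$
   Context: General summation of real numbers $x_1,\ldots,x_n$ ($n\ge 2$): start with the multiset $\mathcal{S}=\{x_1,\ldots,x_n\}$; for $k=2,\ldots,n$ remove two elements $x,y$ from $\mathcal{S}$, set $s_k=x+y$, and add $s_k$ to $\mathcal{S}$; the output is $s_n=\sum_{i=1}^n x_i$. The order of summation (which two elements are removed at each step) is fixed in advance. The computational tree is the binary tree with $2n-1$ vertices whose leaves are the inputs $x_1,\ldots,x_n$, whose internal vertices are the exact partial sums $s_2,\ldots,s_n$ (root $s_n$), where the two children of $s_k$ are the two elements $x,y$ with $s_k=x+y$. Its height $h$ is the length of the longest downward path from the root to a leaf. Floating point model (unit roundoff $0<u<1$, no overflow or underflow): inputs are stored exactly, and if $\hat{x},\hat{y}$ are the computed values of the children of $s_k$ (a leaf has computed value equal to its exact value), the computed value of $s_k$ is $\hat{s}_k=(\hat{x}+\hat{y})(1+\delta_k)$ with $|\delta_k|\le u$, $2\le k\le n$. The $x_i$ (hence the $s_k$) are deterministic. *)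

theory Defs
  imports "HOL-Probability.Probability" "HOL-Library.Multiset"
begin

text \<open>
  Computational trees: \<open>Input i\<close> is the leaf holding \<open>x\<^sub>i\<close>, and \<open>Add k a b\<close> is the internal vertex
  created in step \<open>k\<close>, with children \<open>a\<close> and \<open>b\<close>. The labels distinguish equal input values
  and tie each addition to its rounding error.
\<close>

datatype comp_tree = Input nat | Add nat comp_tree comp_tree

primrec exact_val :: "(nat \<Rightarrow> real) \<Rightarrow> comp_tree \<Rightarrow> real" where
  "exact_val x (Input i) = x i"
| "exact_val x (Add k a b) = exact_val x a + exact_val x b"

primrec computed_val :: "(nat \<Rightarrow> real) \<Rightarrow> (nat \<Rightarrow> real) \<Rightarrow> comp_tree \<Rightarrow> real" where
  "computed_val x d (Input i) = x i"
| "computed_val x d (Add k a b) = (computed_val x d a + computed_val x d b) * (1 + d k)"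

text \<open>The lengths of the downward paths from the root to the leaves.\<close>

primrec leaf_depths :: "comp_tree \<Rightarrow> nat set" where
  "leaf_depths (Input i) = {0}"
| "leaf_depths (Add k a b) = Suc ` (leaf_depths a \<union> leaf_depths b)"

definition tree_height :: "comp_tree \<Rightarrow> nat" where
  "tree_height t = Max (leaf_depths t)"

text \<open>
  A run of general summation on \<open>n\<close> inputs, i.e. an order of summation. \<open>S k\<close> is the multiset after
  step \<open>k\<close> (\<open>S 1\<close> is the initial one), whose elements are represented by the computational trees
  that produce them. \<open>t k\<close>, for \<open>2 \<le> k \<le> n\<close>, is the tree rooted at \<open>s\<^sub>k\<close>, so
  \<open>s\<^sub>k = exact_val x (t k)\<close> and \<open>t n\<close> is the computational tree of the whole summation.
\<close>

definition general_summation :: "nat \<Rightarrow> (nat \<Rightarrow> comp_tree) \<Rightarrow> bool" where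
  "general_summation n t \<longleftrightarrow>
     (\<exists>S :: nat \<Rightarrow> comp_tree multiset.
        S 1 = image_mset Input (mset_set {1..n}) \<and>
        (\<forall>k\<in>{2..n}. \<exists>a b. {#a, b#} \<subseteq># S (k - 1) \<and> t k = Add k a b \<and>
           S k = add_mset (t k) (S (k - 1) - {#a, b#})))"

end

theory Submission
  imports Defs
begin

text \<open>
  A rounding error committed at the node \<open>s\<^sub>k\<close> reaches the root multiplied by \<open>1 + \<delta>\<^sub>j\<close> for every
  strict ancestor \<open>j\<close> of \<open>k\<close>, so that the total error is
  \<open>\<Sum>k. \<delta>\<^sub>k * s\<^sub>k * P\<^sub>k\<close> with \<open>P\<^sub>k = (\<Prod>j\<in>anc k. 1 + \<delta>\<^sub>j)\<close> (\<open>error_expansion\<close>).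
  Ancestors are created after their descendants and therefore carry larger labels. If the \<open>\<delta>\<^sub>k\<close>
  are revealed in the order \<open>\<delta>\<^sub>n, \<dots>, \<delta>\<^sub>2\<close>, from the root towards the leaves, then \<open>P\<^sub>k\<close> is known
  before \<open>\<delta>\<^sub>k\<close> is, and the terms are martingale differences.

  Both probabilistic ingredients come from one Azuma--Hoeffding inequality for sums
  \<open>\<Sum>k. \<delta>\<^sub>k * g\<^sub>k(\<delta>\<^sub>j, j > k)\<close> with bounded weights \<open>g\<^sub>k\<close> (\<open>predictable_sum_tail\<close>).

  First, with the indicator of \<open>anc k\<close> as weight, it bounds \<open>\<Sum>j\<in>anc k. \<delta>\<^sub>j\<close>. There are at most \<open>h\<close>
  ancestors, and \<open>1 + y \<le> exp y\<close>, so \<open>P\<^sub>k \<le> C = exp (lam * sqrt h * u)\<close> fails with probability at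
  most \<open>\<eta> / (2 * n)\<close>; the union over all \<open>k\<close> costs at most \<open>\<eta> / 2\<close>.

  Second, with weights \<open>s\<^sub>k * clip P\<^sub>k\<close>, where \<open>clip\<close> truncates to \<open>{0..C}\<close>, it bounds a sum \<open>Z\<close>
  whose weights are at most \<open>C * \<bar>s\<^sub>k\<bar>\<close> surely; the two tails cost half of the
  allowed failure probability \<open>\<delta>\<close> each. The truncation
  makes the differences bounded without conditioning on the first event, which would destroy
  independence. Where that event holds, truncation changes nothing and \<open>Z\<close> is the error.
\<close>

section \<open>The error as a weighted sum over the computational tree\<close>

primrec addition_labels :: "comp_tree \<Rightarrow> nat set" where
  "addition_labels (Input i) = {}"
| "addition_labels (Add k a b) = insert k (addition_labels a \<union> addition_labels b)"

primrec ancestors :: "comp_tree \<Rightarrow> nat \<Rightarrow> nat set" where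
  "ancestors (Input i) k = {}"
| "ancestors (Add j a b) k =
     (if k \<in> addition_labels a then insert j (ancestors a k)
      else if k \<in> addition_labels b then insert j (ancestors b k) else {})"

text \<open>
  These conditions make labels faithful names of addition nodes: label \<open>k\<close> determines its node,
  which is the root of \<open>t k\<close>, and comparing labels is enough to see that ancestors were created
  later than their descendants.
\<close>

primrec run_tree :: "(nat \<Rightarrow> comp_tree) \<Rightarrow> comp_tree \<Rightarrow> bool" where
  "run_tree t (Input i) \<longleftrightarrow> True"
| "run_tree t (Add k a b) \<longleftrightarrow>
     t k = Add k a b \<and> run_tree t a \<and> run_tree t b \<and>
     addition_labels a \<inter> addition_labels b = {} \<and>
     (\<forall>j\<in>addition_labels a \<union> addition_labels b. j < k)"

lemma finite_addition_labels [simp]: "finite (addition_labels T)"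
  by (induction T) auto

lemma finite_ancestors [simp]: "finite (ancestors T k)"
  by (induction T) auto

lemma ancestors_subset_labels: "ancestors T k \<subseteq> addition_labels T"
  by (induction T) auto

lemma ancestor_label_greater:
  "run_tree t T \<Longrightarrow> j \<in> ancestors T k \<Longrightarrow> k < j"
  by (induction T) (auto split: if_splits)

lemma finite_leaf_depths [simp]: "finite (leaf_depths T)"
  by (induction T) auto

lemma leaf_depths_nonempty [simp]: "leaf_depths T \<noteq> {}"
  by (induction T) auto

lemma tree_height_Add:
  "tree_height (Add k a b) = Suc (max (tree_height a) (tree_height b))"
  unfolding tree_height_def
  by (simp add: mono_Max_commute [symmetric] mono_Suc Max_Un del: image_Un)

lemma card_ancestors_le_height: "card (ancestors T k) \<le> tree_height T"
proof (induction T)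
  case (Add j a b)
  then show ?case
    by (auto simp: tree_height_Add card_insert_if max_def)
qed simp

text \<open>
  Passing from the children to their parent multiplies all errors accumulated so far by \<open>1 + d k\<close>
  and creates the new term \<open>d k * s\<^sub>k\<close>; hence by induction each \<open>d k * s\<^sub>k\<close> collects one factor for
  every strict ancestor of \<open>k\<close>.
\<close>

lemma error_expansion:
  assumes "run_tree t T"
  shows "computed_val x d T - exact_val x T =
    (\<Sum>k\<in>addition_labels T. d k * (exact_val x (t k) * (\<Prod>j\<in>ancestors T k. 1 + d j)))"
  using assms
proof (induction T)
  case (Add k a b)
  define f where "f T i = d i * (exact_val x (t i) * (\<Prod>j\<in>ancestors T i. 1 + d j))" for T i
  have disj: "addition_labels a \<inter> addition_labels b = {}"
    and k: "k \<notin> addition_labels a" "k \<notin> addition_labels b"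
    and tk: "t k = Add k a b"
    using Add.prems by auto
  have k': "k \<notin> ancestors a i" "k \<notin> ancestors b i" for i
    using k ancestors_subset_labels by blast+
  have fa: "f (Add k a b) i = (1 + d k) * f a i" if "i \<in> addition_labels a" for i
    using that k' by (simp add: f_def)
  have fb: "f (Add k a b) i = (1 + d k) * f b i" if "i \<in> addition_labels b" for i
  proof -
    have "i \<notin> addition_labels a"
      using that disj by blast
    then show ?thesis
      using that k' by (simp add: f_def)
  qed
  have "(\<Sum>i\<in>addition_labels (Add k a b). f (Add k a b) i) =
      f (Add k a b) k + (\<Sum>i\<in>addition_labels a. f (Add k a b) i)
        + (\<Sum>i\<in>addition_labels b. f (Add k a b) i)"
    using k disj by (simp add: sum.union_disjoint)
  also have "\<dots> = d k * (exact_val x a + exact_val x b)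
      + (1 + d k) * (\<Sum>i\<in>addition_labels a. f a i) + (1 + d k) * (\<Sum>i\<in>addition_labels b. f b i)"
    using k tk by (simp add: fa fb sum_distrib_left) (simp add: f_def)
  also have "\<dots> = computed_val x d (Add k a b) - exact_val x (Add k a b)"
    using Add.IH Add.prems by (simp add: f_def [symmetric]) (simp add: algebra_simps flip: eq_diff_eq)
  finally show ?case
    by (simp only: f_def)
qed simp

text \<open>
  The invariant is that the label sets of the trees present after step \<open>k\<close> are disjoint
  and have union \<open>{2..k}\<close>. It is stated with multisets, so that it also excludes a label occurring in two of the trees. The
  size of \<open>S k\<close> drops by one per step, and after \<open>n\<close> steps only \<open>t n\<close> is left.
\<close>

lemma general_summation_run_tree:
  assumes run: "general_summation n t" and "n \<ge> 2"
  shows "run_tree t (t n) \<and> addition_labels (t n) = {2..n}"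
proof -
  obtain S :: "nat \<Rightarrow> comp_tree multiset" where
    S1: "S 1 = image_mset Input (mset_set {1..n})" and
    step: "\<And>k. k \<in> {2..n} \<Longrightarrow> \<exists>a b. {#a, b#} \<subseteq># S (k - 1) \<and> t k = Add k a b \<and>
           S k = add_mset (t k) (S (k - 1) - {#a, b#})"
    using run unfolding general_summation_def by blast
  define L where "L T = mset_set (addition_labels T)" for T
  have inv: "(\<forall>T\<in>#S k. run_tree t T) \<and> (\<Sum>T\<in>#S k. L T) = mset_set {2..k} \<and> size (S k) + k = n + 1"
    if "1 \<le> k" "k \<le> n" for k
    using that
  proof (induction k rule: nat_induct_at_least)
    case base
    show ?case
      unfolding S1 by (simp add: L_def image_mset.compositionality comp_def)
  next
    case (Suc k)
    obtain a b where ab: "{#a, b#} \<subseteq># S k" and t: "t (Suc k) = Add (Suc k) a b"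
      and S: "S (Suc k) = add_mset (t (Suc k)) (S k - {#a, b#})"
      using step[of "Suc k"] Suc.hyps Suc.prems by auto
    obtain R where R: "S k = {#a, b#} + R"
      using ab by (auto simp: subset_mset.le_iff_add)
    have IH: "\<forall>T\<in>#S k. run_tree t T" "(\<Sum>T\<in>#S k. L T) = mset_set {2..k}" "size (S k) + k = n + 1"
      using Suc by auto
    have split: "L a + L b + (\<Sum>T\<in>#R. L T) = mset_set {2..k}"
      using IH(2) by (simp add: R ac_simps)
    have count: "count (L T) i = (if i \<in> addition_labels T then 1 else 0)" for T i
      by (simp add: L_def count_mset_set')
    \<comment> \<open>Every label occurs at most once in \<open>a\<close> and \<open>b\<close> together, and only if it lies in \<open>{2..k}\<close>.\<close>
    have le1: "count (L a) i + count (L b) i \<le> count (mset_set {2..k}) i" for i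
      unfolding split [symmetric] by simp
    have disj: "addition_labels a \<inter> addition_labels b = {}"
    proof safe
      fix i assume "i \<in> addition_labels a" "i \<in> addition_labels b"
      then show "i \<in> {}"
        using le1[of i] by (simp add: count count_mset_set' split: if_splits)
    qed
    have less: "i < Suc k" if "i \<in> addition_labels a \<union> addition_labels b" for i
      using that le1[of i] by (auto simp: count count_mset_set' split: if_splits)
    have k: "Suc k \<notin> addition_labels a \<union> addition_labels b"
      using less by blast
    have "L (t (Suc k)) = add_mset (Suc k) (L a + L b)"
      using k disj unfolding t L_def by (simp add: mset_set_Union)
    then have "(\<Sum>T\<in>#S (Suc k). L T) = add_mset (Suc k) (L a + L b + (\<Sum>T\<in>#R. L T))"
      unfolding S R by simp
    also have "\<dots> = mset_set {2..Suc k}"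
    proof -
      have "{2..Suc k} = insert (Suc k) {2..k}"
        using Suc.hyps by auto
      then show ?thesis
        unfolding split by simp
    qed
    finally have "(\<Sum>T\<in>#S (Suc k). L T) = mset_set {2..Suc k}" .
    moreover have "run_tree t (t (Suc k))"
      using IH(1) disj less t by (auto simp: R)
    moreover have "\<forall>T\<in>#R. run_tree t T"
      using IH(1) by (simp add: R)
    moreover have "size (S (Suc k)) + Suc k = n + 1"
      using IH(3) by (simp add: S R)
    ultimately show ?case
      by (auto simp: S R)
  qed
  have fin: "(\<forall>T\<in>#S n. run_tree t T) \<and> (\<Sum>T\<in>#S n. L T) = mset_set {2..n} \<and> size (S n) + n = n + 1"
    using inv[of n] \<open>n \<ge> 2\<close> by simp
  have "t n \<in># S n"
    using step[of n] \<open>n \<ge> 2\<close> by auto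
  moreover have "size (S n) = 1"
    using fin by simp
  then obtain T where "S n = {#T#}"
    using size_1_singleton_mset by blast
  ultimately have "S n = {#t n#}"
    by simp
  then show ?thesis
    using fin by (simp add: L_def mset_set_eq_iff)
qed

section \<open>Sub-Gaussian tails for predictable weights\<close>

text \<open>
  The function \<open>cosh\<close> is the moment generating function of a uniform sign, so this is Hoeffding's
  lemma for the interval \<open>{-1..1}\<close>. Its analytic core is used at \<open>p = 1/2\<close> and \<open>h = 2 * \<bar>x\<bar>\<close>.
\<close>

lemma cosh_le_exp_half_square: "cosh (x :: real) \<le> exp (x\<^sup>2 / 2)"
proof -
  define y where "y = \<bar>x\<bar>"
  have pos: "1 + 1/2 * (exp (2 * y) - 1) > 0"
    by (simp add: field_simps add_pos_pos)
  have "- (2 * y) * (1/2) + ln (1 + 1/2 * (exp (2 * y) - 1)) \<le> (2 * y)\<^sup>2 / 8"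
    by (rule Hoeffdings_lemma_aux) (auto simp: y_def)
  then have "ln (1 + 1/2 * (exp (2 * y) - 1)) \<le> y + y\<^sup>2 / 2"
    by (simp add: power_mult_distrib)
  then have "1 + 1/2 * (exp (2 * y) - 1) \<le> exp (y + y\<^sup>2 / 2)"
    using pos by (metis exp_le_cancel_iff exp_ln)
  moreover have "1 + 1/2 * (exp (2 * y) - 1) = exp y * cosh y"
    by (simp add: cosh_def field_simps exp_minus flip: exp_add)
  ultimately have "cosh y \<le> exp (y\<^sup>2 / 2)"
    by (simp add: exp_add)
  then show ?thesis
    by (simp add: y_def)
qed

text \<open>
  The right-hand side is the chord of the convex function \<open>\<lambda>x. exp (x * g)\<close> over \<open>{-u..u}\<close>. It is
  affine in \<open>x\<close>, so only the constant term survives averaging over a centred \<open>x\<close>, even if \<open>g\<close> is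
  random, provided that \<open>g\<close> is independent of \<open>x\<close>.
\<close>

lemma exp_mult_le_chord:
  fixes g u x :: real
  assumes "0 < u" and "\<bar>x\<bar> \<le> u"
  shows "exp (x * g) \<le> cosh (u * g) + x * (sinh (u * g) / u)"
proof -
  define y where "y = (u + x) / (2 * u)"
  have y: "0 \<le> y" "y \<le> 1"
    using assms by (auto simp: y_def field_simps)
  have x: "x = (1 - y) * - u + y * u"
    using assms by (simp add: y_def field_simps)
  have "exp (1 * ((1 - y) *\<^sub>R (- u * g) + y *\<^sub>R (u * g)))
      \<le> (1 - y) * exp (1 * (- u * g)) + y * exp (1 * (u * g))"
    using y by (intro convex_onD[OF convex_on_exp]) auto
  also have "1 * ((1 - y) *\<^sub>R (- u * g) + y *\<^sub>R (u * g)) = x * g"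
    by (subst x) (simp add: algebra_simps)
  also have "(1 - y) * exp (1 * (- u * g)) + y * exp (1 * (u * g))
      = cosh (u * g) + (2 * y - 1) * sinh (u * g)"
    by (simp add: cosh_def sinh_def field_simps)
  also have "2 * y - 1 = x / u"
    using assms by (simp add: y_def field_simps)
  finally show ?thesis by simp
qed

text \<open>
  Induction on \<open>I\<close>, adding a new smallest index \<open>k\<close>: the earlier sum \<open>F\<close> and the weight \<open>g k\<close> are
  functions of the variables with larger index, hence independent of \<open>D k\<close>. The chord bound makes
  the new factor affine in \<open>D k\<close>; its linear part has expectation zero by independence, and its
  constant part is at most \<open>cosh (u * c k) \<le> exp ((u * c k)\<^sup>2 / 2)\<close>. Restricting the argument of
  \<open>g k\<close> to the larger indices is what encodes predictability.
\<close>

lemma (in prob_space) predictable_sum_mgf_le: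
  fixes D :: "'b::linorder \<Rightarrow> 'a \<Rightarrow> real" and g :: "'b \<Rightarrow> ('b \<Rightarrow> real) \<Rightarrow> real"
  assumes "finite I" and "0 < u"
    and "indep_vars (\<lambda>_. borel) D I"
    and "\<And>k. k \<in> I \<Longrightarrow> expectation (D k) = 0"
    and "\<And>k. k \<in> I \<Longrightarrow> AE \<omega> in M. \<bar>D k \<omega>\<bar> \<le> u"
    and "\<And>k. k \<in> I \<Longrightarrow> g k \<in> borel_measurable (PiM {j\<in>I. k < j} (\<lambda>_. borel))"
    and "\<And>k v. k \<in> I \<Longrightarrow> \<bar>g k v\<bar> \<le> c k"
  defines "W \<equiv> \<lambda>\<omega>. \<Sum>k\<in>I. D k \<omega> * g k (\<lambda>j\<in>{j\<in>I. k < j}. D j \<omega>)"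
  shows "integrable M (\<lambda>\<omega>. exp (W \<omega>)) \<and> expectation (\<lambda>\<omega>. exp (W \<omega>)) \<le> exp (u\<^sup>2 * (\<Sum>k\<in>I. (c k)\<^sup>2) / 2)"
  using assms(1,3-7) unfolding W_def
proof (induction I rule: finite_linorder_min_induct)
  case empty
  then show ?case by (simp add: prob_space)
next
  case (insert k A)
  note indep = insert.prems(1)
  have later: "{j \<in> insert k A. i < j} = {j\<in>A. i < j}" if "i \<in> A" for i
    using that insert.hyps by auto
  have later_k: "{j \<in> insert k A. k < j} = A"
    using insert.hyps by auto
  have k: "k \<notin> A"
    using insert.hyps by auto
  define X where "X \<omega> = (\<lambda>j\<in>A. D j \<omega>)" for \<omega>
  define F where "F v = (\<Sum>i\<in>A. v i * g i (\<lambda>j\<in>{j\<in>A. i < j}. v j))" for v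
  have g_meas [measurable]: "g i \<in> borel_measurable (PiM {j\<in>A. i < j} (\<lambda>_. borel))" if "i \<in> A" for i
    using insert.prems(4)[of i] that later by simp
  have gk [measurable]: "g k \<in> borel_measurable (PiM A (\<lambda>_. borel))"
    using insert.prems(4)[of k] later_k by simp
  have F_meas [measurable]: "F \<in> borel_measurable (PiM A (\<lambda>_. borel))"
    unfolding F_def
  proof (intro borel_measurable_sum borel_measurable_times)
    fix i assume i: "i \<in> A"
    show "(\<lambda>v. v i) \<in> borel_measurable (PiM A (\<lambda>_. borel))"
      using i by (rule measurable_component_singleton)
    show "(\<lambda>v. g i (\<lambda>j\<in>{j\<in>A. i < j}. v j)) \<in> borel_measurable (PiM A (\<lambda>_. borel))"
      by (rule measurable_compose[OF measurable_restrict_subset g_meas[OF i]]) auto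
  qed
  have D_meas [measurable]: "D i \<in> borel_measurable M" if "i \<in> insert k A" for i
    using indep that unfolding indep_vars_def by blast
  have X_meas [measurable]: "X \<in> measurable M (PiM A (\<lambda>_. borel))"
    unfolding X_def by (intro measurable_restrict D_meas) auto
  have FX: "F (X \<omega>) = (\<Sum>i\<in>A. D i \<omega> * g i (\<lambda>j\<in>{j\<in>A. i < j}. D j \<omega>))" for \<omega>
  proof -
    have "(\<lambda>j\<in>{j\<in>A. i < j}. X \<omega> j) = (\<lambda>j\<in>{j\<in>A. i < j}. D j \<omega>)" for i
      by (auto simp: X_def)
    then show ?thesis
      unfolding F_def by (intro sum.cong refl) (simp, simp add: X_def)
  qed
  have FX': "F (X \<omega>) = (\<Sum>i\<in>A. D i \<omega> * g i (\<lambda>j\<in>{j \<in> insert k A. i < j}. D j \<omega>))" for \<omega>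
    unfolding FX by (intro sum.cong refl) (simp only: later)
  have IH: "integrable M (\<lambda>\<omega>. exp (F (X \<omega>)))"
    "expectation (\<lambda>\<omega>. exp (F (X \<omega>))) \<le> exp (u\<^sup>2 * (\<Sum>k\<in>A. (c k)\<^sup>2) / 2)"
  proof -
    have "integrable M (\<lambda>\<omega>. exp (\<Sum>i\<in>A. D i \<omega> * g i (\<lambda>j\<in>{j\<in>A. i < j}. D j \<omega>))) \<and>
      expectation (\<lambda>\<omega>. exp (\<Sum>i\<in>A. D i \<omega> * g i (\<lambda>j\<in>{j\<in>A. i < j}. D j \<omega>)))
        \<le> exp (u\<^sup>2 * (\<Sum>k\<in>A. (c k)\<^sup>2) / 2)"
      by (rule insert.IH)
        (use insert.prems g_meas indep in \<open>auto intro: indep_vars_subset\<close>)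
    then show "integrable M (\<lambda>\<omega>. exp (F (X \<omega>)))"
      "expectation (\<lambda>\<omega>. exp (F (X \<omega>))) \<le> exp (u\<^sup>2 * (\<Sum>k\<in>A. (c k)\<^sup>2) / 2)"
      by (simp_all add: FX)
  qed
  have c: "\<bar>g k v\<bar> \<le> c k" for v
    using insert.prems(5)[of k] by simp
  have ug: "\<bar>u * g k v\<bar> \<le> u * c k" for v
    using c[of v] \<open>0 < u\<close> by (simp add: abs_mult)
  have cosh_le: "cosh (u * g k v) \<le> cosh (u * c k)" for v
  proof -
    have "cosh \<bar>u * g k v\<bar> \<le> cosh (u * c k)"
      using ug[of v] by (subst cosh_real_nonneg_le_iff) auto
    then show ?thesis by simp
  qed
  have sinh_le: "\<bar>sinh (u * g k v)\<bar> \<le> cosh (u * c k)" for v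
  proof -
    have "\<bar>sinh (u * g k v)\<bar> \<le> cosh (u * g k v)"
      using cosh_plus_sinh[of "u * g k v"] cosh_minus_sinh[of "u * g k v"]
        exp_gt_zero[of "u * g k v"] exp_gt_zero[of "- (u * g k v)"] by linarith
    then show ?thesis using cosh_le[of v] by linarith
  qed
  define H where "H v = exp (F v) * (sinh (u * g k v) / u)" for v
  define K where "K v = exp (F v) * cosh (u * g k v)" for v
  have cm: "(cosh :: real \<Rightarrow> real) \<in> borel_measurable borel" "(sinh :: real \<Rightarrow> real) \<in> borel_measurable borel"
    by (intro borel_measurable_continuous_onI continuous_intros)+
  note [measurable] = cm
  have H_meas [measurable]: "H \<in> borel_measurable (PiM A (\<lambda>_. borel))"
    unfolding H_def by measurable
  have K_meas [measurable]: "K \<in> borel_measurable (PiM A (\<lambda>_. borel))"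
    unfolding K_def by measurable
  have K_int: "integrable M (\<lambda>\<omega>. K (X \<omega>))"
  proof (rule Bochner_Integration.integrable_bound)
    show "integrable M (\<lambda>\<omega>. exp (F (X \<omega>)) * cosh (u * c k))"
      using IH(1) by simp
    show "AE \<omega> in M. norm (K (X \<omega>)) \<le> norm (exp (F (X \<omega>)) * cosh (u * c k))"
      using cosh_le by (intro AE_I2) (simp add: K_def abs_mult)
  qed measurable
  have H_int: "integrable M (\<lambda>\<omega>. H (X \<omega>))"
  proof (rule Bochner_Integration.integrable_bound)
    show "integrable M (\<lambda>\<omega>. exp (F (X \<omega>)) * (cosh (u * c k) / u))"
      using IH(1) by simp
    show "AE \<omega> in M. norm (H (X \<omega>)) \<le> norm (exp (F (X \<omega>)) * (cosh (u * c k) / u))"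
      using sinh_le \<open>0 < u\<close> by (intro AE_I2) (simp add: H_def abs_mult divide_right_mono)
  qed measurable
  have Dk_bound: "AE \<omega> in M. \<bar>D k \<omega>\<bar> \<le> u"
    using insert.prems(3)[of k] by simp
  have Dk_int: "integrable M (D k)"
    using Dk_bound by (intro integrable_const_bound[where B = u]) auto
  have "indep_var (PiM {k} (\<lambda>_. borel)) (\<lambda>\<omega>. \<lambda>j\<in>{k}. D j \<omega>) (PiM A (\<lambda>_. borel)) (\<lambda>\<omega>. \<lambda>j\<in>A. D j \<omega>)"
    by (rule indep_var_restrict[OF indep]) (use k in auto)
  then have "indep_var borel ((\<lambda>v. v k) \<circ> (\<lambda>\<omega>. \<lambda>j\<in>{k}. D j \<omega>)) borel (H \<circ> (\<lambda>\<omega>. \<lambda>j\<in>A. D j \<omega>))"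
    by (rule indep_var_compose) (auto intro!: measurable_component_singleton)
  then have ind: "indep_var borel (D k) borel (\<lambda>\<omega>. H (X \<omega>))"
    by (simp add: comp_def X_def)
  have DH_int: "integrable M (\<lambda>\<omega>. D k \<omega> * H (X \<omega>))"
    by (rule indep_var_integrable[OF ind Dk_int H_int])
  have "expectation (\<lambda>\<omega>. D k \<omega> * H (X \<omega>)) = expectation (D k) * expectation (\<lambda>\<omega>. H (X \<omega>))"
    by (rule indep_var_lebesgue_integral[OF ind Dk_int H_int])
  then have DH0: "expectation (\<lambda>\<omega>. D k \<omega> * H (X \<omega>)) = 0"
    using insert.prems(2)[of k] by simp
  define Z where "Z \<omega> = exp (D k \<omega> * g k (X \<omega>) + F (X \<omega>))" for \<omega>
  have Z_le: "AE \<omega> in M. Z \<omega> \<le> K (X \<omega>) + D k \<omega> * H (X \<omega>)"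
    using Dk_bound
  proof eventually_elim
    case (elim \<omega>)
    have "exp (F (X \<omega>)) * exp (D k \<omega> * g k (X \<omega>))
        \<le> exp (F (X \<omega>)) * (cosh (u * g k (X \<omega>)) + D k \<omega> * (sinh (u * g k (X \<omega>)) / u))"
      using exp_mult_le_chord[OF \<open>0 < u\<close> elim] by (intro mult_left_mono) auto
    then show ?case
      by (simp add: Z_def K_def H_def exp_add algebra_simps)
  qed
  have Dk_meas [measurable]: "D k \<in> borel_measurable M"
    by (rule D_meas) simp
  have Z_int: "integrable M Z"
  proof (rule Bochner_Integration.integrable_bound)
    show "integrable M (\<lambda>\<omega>. K (X \<omega>) + D k \<omega> * H (X \<omega>))"
      using K_int DH_int by simp
    show "Z \<in> borel_measurable M"
      unfolding Z_def by measurable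
    show "AE \<omega> in M. norm (Z \<omega>) \<le> norm (K (X \<omega>) + D k \<omega> * H (X \<omega>))"
      using Z_le by eventually_elim (simp add: Z_def)
  qed
  have "expectation Z \<le> expectation (\<lambda>\<omega>. K (X \<omega>) + D k \<omega> * H (X \<omega>))"
    using K_int DH_int Z_int Z_le by (intro integral_mono_AE) auto
  also have "\<dots> = expectation (\<lambda>\<omega>. K (X \<omega>))"
    using K_int DH_int DH0 by simp
  also have "\<dots> \<le> expectation (\<lambda>\<omega>. exp (F (X \<omega>)) * cosh (u * c k))"
    using K_int IH(1) cosh_le by (intro integral_mono) (auto simp: K_def)
  also have "\<dots> = expectation (\<lambda>\<omega>. exp (F (X \<omega>))) * cosh (u * c k)"
    by simp
  also have "\<dots> \<le> exp (u\<^sup>2 * (\<Sum>k\<in>A. (c k)\<^sup>2) / 2) * exp ((u * c k)\<^sup>2 / 2)"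
    by (intro mult_mono IH(2) cosh_le_exp_half_square) auto
  also have "\<dots> = exp (u\<^sup>2 * (\<Sum>k\<in>insert k A. (c k)\<^sup>2) / 2)"
    using k insert.hyps by (simp add: exp_add [symmetric] field_simps)
  finally have "expectation Z \<le> exp (u\<^sup>2 * (\<Sum>k\<in>insert k A. (c k)\<^sup>2) / 2)" .
  moreover have "(\<Sum>i\<in>insert k A. D i \<omega> * g i (\<lambda>j\<in>{j \<in> insert k A. i < j}. D j \<omega>))
      = D k \<omega> * g k (X \<omega>) + F (X \<omega>)" for \<omega>
    using k insert.hyps(1) unfolding FX' sum.insert[OF insert.hyps(1) k] by (simp only: later_k X_def)
  ultimately show ?case
    using Z_int unfolding Z_def by (simp only: simp_thms)
qed

text \<open>
  This is Chernoff's bound with the optimal exponent \<open>a / (u * sqrt V)\<close>. Taking an upper bound \<open>V\<close>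
  in place of the sum of squares keeps that exponent defined when all weights vanish, as for a
  node that has no ancestors.
\<close>

lemma (in prob_space) predictable_sum_tail:
  fixes D :: "'b::linorder \<Rightarrow> 'a \<Rightarrow> real" and g :: "'b \<Rightarrow> ('b \<Rightarrow> real) \<Rightarrow> real"
  assumes I: "finite I" and u: "0 < u"
    and indep: "indep_vars (\<lambda>_. borel) D I"
    and mean: "\<And>k. k \<in> I \<Longrightarrow> expectation (D k) = 0"
    and bound: "\<And>k. k \<in> I \<Longrightarrow> AE \<omega> in M. \<bar>D k \<omega>\<bar> \<le> u"
    and g_meas: "\<And>k. k \<in> I \<Longrightarrow> g k \<in> borel_measurable (PiM {j\<in>I. k < j} (\<lambda>_. borel))"
    and g_le: "\<And>k v. k \<in> I \<Longrightarrow> \<bar>g k v\<bar> \<le> c k"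
    and V: "(\<Sum>k\<in>I. (c k)\<^sup>2) \<le> V" "0 < V" and a: "0 < a"
  shows "prob {\<omega> \<in> space M. a * u * sqrt V \<le> (\<Sum>k\<in>I. D k \<omega> * g k (\<lambda>j\<in>{j\<in>I. k < j}. D j \<omega>))}
    \<le> exp (- a\<^sup>2 / 2)"
proof -
  define W where "W \<omega> = (\<Sum>k\<in>I. D k \<omega> * g k (\<lambda>j\<in>{j\<in>I. k < j}. D j \<omega>))" for \<omega>
  define \<theta> where "\<theta> = a / (u * sqrt V)"
  have \<theta>: "\<theta> > 0"
    using u V a by (simp add: \<theta>_def)
  have "integrable M (\<lambda>\<omega>. exp (\<Sum>k\<in>I. D k \<omega> * (\<theta> * g k (\<lambda>j\<in>{j\<in>I. k < j}. D j \<omega>)))) \<and>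
     expectation (\<lambda>\<omega>. exp (\<Sum>k\<in>I. D k \<omega> * (\<theta> * g k (\<lambda>j\<in>{j\<in>I. k < j}. D j \<omega>))))
       \<le> exp (u\<^sup>2 * (\<Sum>k\<in>I. (\<theta> * c k)\<^sup>2) / 2)"
    by (rule predictable_sum_mgf_le[where g = "\<lambda>k v. \<theta> * g k v"])
      (use assms \<theta> in \<open>auto simp: abs_mult intro!: borel_measurable_times\<close>)
  moreover have "(\<Sum>k\<in>I. D k \<omega> * (\<theta> * g k (\<lambda>j\<in>{j\<in>I. k < j}. D j \<omega>))) = \<theta> * W \<omega>" for \<omega>
    by (simp add: W_def sum_distrib_left mult_ac)
  ultimately have int: "integrable M (\<lambda>\<omega>. exp (\<theta> * W \<omega>))"
    and le: "expectation (\<lambda>\<omega>. exp (\<theta> * W \<omega>)) \<le> exp (u\<^sup>2 * (\<Sum>k\<in>I. (\<theta> * c k)\<^sup>2) / 2)"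
    by simp_all
  have "prob {\<omega> \<in> space M. a * u * sqrt V \<le> W \<omega>}
      \<le> exp (- \<theta> * (a * u * sqrt V)) * (\<integral>\<omega>\<in>space M. exp (\<theta> * W \<omega>) \<partial>M)"
    by (rule Chernoff_ineq_ge[OF \<theta>]) (use integrable_mult_indicator[OF sets.top int] in \<open>simp_all add: set_integrable_def\<close>)
  also have "(\<integral>\<omega>\<in>space M. exp (\<theta> * W \<omega>) \<partial>M) = expectation (\<lambda>\<omega>. exp (\<theta> * W \<omega>))"
    using int by (simp add: set_integral_space)
  also have "exp (- \<theta> * (a * u * sqrt V)) * expectation (\<lambda>\<omega>. exp (\<theta> * W \<omega>))
      \<le> exp (- \<theta> * (a * u * sqrt V)) * exp (u\<^sup>2 * (\<Sum>k\<in>I. (\<theta> * c k)\<^sup>2) / 2)"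
    using le by (intro mult_left_mono) auto
  also have "\<dots> \<le> exp (- a\<^sup>2 / 2)"
  proof -
    have "- \<theta> * (a * u * sqrt V) = - a\<^sup>2"
      using u V by (simp add: \<theta>_def power2_eq_square)
    moreover have "u\<^sup>2 * (\<Sum>k\<in>I. (\<theta> * c k)\<^sup>2) = u\<^sup>2 * \<theta>\<^sup>2 * (\<Sum>k\<in>I. (c k)\<^sup>2)"
      by (simp add: power_mult_distrib sum_distrib_left mult_ac)
    moreover have "u\<^sup>2 * \<theta>\<^sup>2 * (\<Sum>k\<in>I. (c k)\<^sup>2) \<le> u\<^sup>2 * \<theta>\<^sup>2 * V"
      using V by (intro mult_left_mono) auto
    moreover have "u\<^sup>2 * \<theta>\<^sup>2 * V = a\<^sup>2"
      using u V by (simp add: \<theta>_def power_divide power_mult_distrib)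
    ultimately show ?thesis
      unfolding exp_add [symmetric] exp_le_cancel_iff by linarith
  qed
  finally show ?thesis
    by (simp add: W_def)
qed

section \<open>The error bound\<close>

theorem theorem2p6:
  fixes M :: "'a measure"
    and D :: "nat \<Rightarrow> 'a \<Rightarrow> real"
    and x :: "nat \<Rightarrow> real"
    and t :: "nat \<Rightarrow> comp_tree"
    and n h :: nat
    and u \<delta> \<eta> lam :: real
    and s :: "nat \<Rightarrow> real"
    and s_hat :: "nat \<Rightarrow> 'a \<Rightarrow> real"
  assumes "n \<ge> 2"
    and "0 < u" and "u < 1"
    and "general_summation n t"
    and h_def: "h = tree_height (t n)"
    and s_def: "\<And>k. s k = exact_val x (t k)"
    and s_hat_def: "\<And>k \<omega>. s_hat k \<omega> = computed_val x (\<lambda>j. D j \<omega>) (t k)"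
    and "prob_space M"
    and "prob_space.indep_vars M (\<lambda>_. borel) D {2..n}"
    and "\<And>k. k \<in> {2..n} \<Longrightarrow> integral\<^sup>L M (D k) = 0"
    and "\<And>k. k \<in> {2..n} \<Longrightarrow> AE \<omega> in M. \<bar>D k \<omega>\<bar> \<le> u"
    and "0 < \<delta>" and "\<delta> < 1"
    and "0 < \<eta>" and "\<eta> < 1"
    and lam_def: "lam = sqrt (2 * ln (2 * real n / \<eta>))"
  shows "measure M {\<omega> \<in> space M.
           \<bar>s_hat n \<omega> - s n\<bar> \<le>
             u * exp (lam * sqrt (real h) * u) * sqrt (\<Sum>k=2..n. (s k)\<^sup>2) * sqrt (2 * ln (2 / \<delta>))}
         \<ge> 1 - (\<delta> + \<eta>)"
proof -
  interpret prob_space M by fact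
  define I where "I = {2..n}"
  define anc where "anc k = ancestors (t n) k" for k
  define C where "C = exp (lam * sqrt (real h) * u)"
  define P where "P k v = (\<Prod>j\<in>anc k. 1 + v j)" for k and v :: "nat \<Rightarrow> real"
  define clip where "clip y = max 0 (min C y)" for y :: real
  define V where "V = (\<Sum>k\<in>I. (s k)\<^sup>2)"
  define a where "a = sqrt (2 * ln (2 / \<delta>))"
  define \<epsilon> where "\<epsilon> = u * C * sqrt V * a"
  define good where "good = {\<omega> \<in> space M. \<bar>s_hat n \<omega> - s n\<bar> \<le> \<epsilon>}"
  have run: "run_tree t (t n)" and labels: "addition_labels (t n) = I"
    using general_summation_run_tree[of n t] assms by (auto simp: I_def)
  have [simp]: "finite I" "card I = n - 1"
    by (simp_all add: I_def)
  have indep: "indep_vars (\<lambda>_. borel) D I"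
    using assms by (simp add: I_def)
  have mean: "\<And>k. k \<in> I \<Longrightarrow> expectation (D k) = 0"
    and bound: "\<And>k. k \<in> I \<Longrightarrow> AE \<omega> in M. \<bar>D k \<omega>\<bar> \<le> u"
    using assms by (auto simp: I_def)
  have D_meas [measurable]: "D k \<in> borel_measurable M" if "k \<in> I" for k
    using indep that unfolding indep_vars_def by blast
  have anc_later: "anc k \<subseteq> {j\<in>I. k < j}" for k
    using ancestors_subset_labels ancestor_label_greater[OF run] labels by (auto simp: anc_def)
  have anc_I: "anc k \<subseteq> I" and fin_anc [simp]: "finite (anc k)" for k
    using anc_later by (auto simp: anc_def)
  have card_anc: "card (anc k) \<le> h" for k
    using card_ancestors_le_height by (simp add: anc_def h_def)
  have "n \<in> I"
    using \<open>n \<ge> 2\<close> by (simp add: I_def)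
  then have "h \<ge> 1"
    using labels by (cases "t n") (auto simp: h_def tree_height_Add)
  have "\<eta> < 2 * real n"
    using assms by linarith
  then have ln_pos: "0 < ln (2 * real n / \<eta>)"
    using assms by simp
  then have "lam > 0"
    by (simp add: lam_def)
  have "0 < ln (2 / \<delta>)"
    using assms by simp
  then have "a > 0"
    by (simp add: a_def)
  have "C > 0"
    by (simp add: C_def)

  have error: "s_hat n \<omega> - s n = (\<Sum>k\<in>I. D k \<omega> * (s k * P k (\<lambda>j. D j \<omega>)))" for \<omega>
    using error_expansion[OF run, of x "\<lambda>j. D j \<omega>"]
    by (simp add: s_hat_def s_def labels P_def anc_def)
  have P_meas: "(\<lambda>\<omega>. P k (\<lambda>j. D j \<omega>)) \<in> borel_measurable M" for k
    unfolding P_def using anc_I by (intro borel_measurable_prod borel_measurable_add D_meas) auto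
  have err_meas: "(\<lambda>\<omega>. s_hat n \<omega> - s n) \<in> borel_measurable M"
    unfolding error by (intro borel_measurable_sum borel_measurable_times D_meas P_meas) auto
  have good_sets [measurable]: "good \<in> events"
    unfolding good_def using err_meas by measurable

  have "1 - (\<delta> + \<eta>) \<le> prob good"
  proof (cases "V = 0")
    \<comment> \<open>All partial sums vanish, and with them the error.\<close>
    case True
    then have "s k = 0" if "k \<in> I" for k
      using that by (simp add: V_def sum_nonneg_eq_0_iff)
    then have "good = space M"
      using True by (auto simp: good_def error \<epsilon>_def)
    then show ?thesis
      using assms by (simp add: prob_space)
  next
    case False
    then have "V > 0"
      by (metis V_def order_le_less sum_nonneg zero_le_power2)
    \<comment> \<open>\<open>B k\<close> contains the event that the amplification \<open>P k\<close> exceeds \<open>C\<close>; the sign \<open>r = 1\<close> or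
      \<open>r = - 1\<close> in \<open>E r\<close> selects the upper or the lower tail of \<open>Z\<close>.\<close>
    define B where "B k = {\<omega> \<in> space M. lam * u * sqrt (real h) \<le> (\<Sum>j\<in>anc k. D j \<omega>)}" for k
    define Z where "Z \<omega> = (\<Sum>k\<in>I. D k \<omega> * (s k * clip (P k (\<lambda>j. D j \<omega>))))" for \<omega>
    define E where "E r = {\<omega> \<in> space M. \<epsilon> \<le> r * Z \<omega>}" for r :: real
    have B_prob: "prob (B k) \<le> \<eta> / (2 * real n)" for k
    proof -
      have "(\<Sum>i\<in>I. (if i \<in> anc k then 1 else 0 :: real)\<^sup>2) = real (card (anc k))"
        using anc_I by (simp add: if_distrib[of "\<lambda>y. y\<^sup>2"] sum.If_cases Int_absorb1 cong: if_cong)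
      then have "prob {\<omega> \<in> space M. lam * u * sqrt (real h) \<le>
          (\<Sum>i\<in>I. D i \<omega> * (if i \<in> anc k then 1 else 0))} \<le> exp (- lam\<^sup>2 / 2)"
        using card_anc[of k] \<open>h \<ge> 1\<close> \<open>lam > 0\<close> \<open>0 < u\<close>
        by (intro predictable_sum_tail[where g = "\<lambda>i _. if i \<in> anc k then 1 else 0"
              and c = "\<lambda>i. if i \<in> anc k then 1 else 0"] indep mean bound) auto
      moreover have "(\<Sum>i\<in>I. D i \<omega> * (if i \<in> anc k then 1 else 0)) = (\<Sum>j\<in>anc k. D j \<omega>)" for \<omega>
        using anc_I by (simp add: if_distrib sum.If_cases Int_absorb1 cong: if_cong)
      moreover have "exp (- lam\<^sup>2 / 2) = \<eta> / (2 * real n)"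
        using ln_pos assms by (simp add: lam_def exp_minus)
      ultimately show ?thesis
        by (simp add: B_def)
    qed
    have E_prob: "prob (E r) \<le> \<delta> / 2" if r: "\<bar>r\<bar> = 1" for r
    proof -
      define g where "g k v = r * s k * clip (P k v)" for k v
      have clip_abs: "\<bar>clip y\<bar> \<le> C" for y
        using \<open>C > 0\<close> by (simp add: clip_def)
      have "prob {\<omega> \<in> space M. a * u * sqrt (C\<^sup>2 * V) \<le>
          (\<Sum>k\<in>I. D k \<omega> * g k (\<lambda>j\<in>{j\<in>I. k < j}. D j \<omega>))} \<le> exp (- a\<^sup>2 / 2)"
      proof (rule predictable_sum_tail[where c = "\<lambda>k. \<bar>s k\<bar> * C"])
        show "g k \<in> borel_measurable (PiM {j\<in>I. k < j} (\<lambda>_. borel))" for k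
        proof -
          have "(\<lambda>v. P k v) \<in> borel_measurable (PiM {j\<in>I. k < j} (\<lambda>_. borel))"
            unfolding P_def using anc_later[of k]
            by (intro borel_measurable_prod borel_measurable_add measurable_component_singleton) auto
          then show ?thesis
            unfolding g_def clip_def by measurable
        qed
        show "\<bar>g k v\<bar> \<le> \<bar>s k\<bar> * C" for k v
          using clip_abs r by (simp add: g_def abs_mult mult_left_mono)
        show "(\<Sum>k\<in>I. (\<bar>s k\<bar> * C)\<^sup>2) \<le> C\<^sup>2 * V"
          by (simp add: V_def power_mult_distrib sum_distrib_left mult.commute)
      qed (use indep mean bound \<open>0 < u\<close> \<open>C > 0\<close> \<open>V > 0\<close> \<open>a > 0\<close> in auto)
      moreover have "P k (\<lambda>j\<in>{j\<in>I. k < j}. D j \<omega>) = P k (\<lambda>j. D j \<omega>)" for k \<omega>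
        unfolding P_def using anc_later[of k] by (intro prod.cong refl) auto
      then have "(\<Sum>k\<in>I. D k \<omega> * g k (\<lambda>j\<in>{j\<in>I. k < j}. D j \<omega>)) = r * Z \<omega>" for \<omega>
        by (simp add: g_def Z_def sum_distrib_left mult_ac)
      moreover have "a * u * sqrt (C\<^sup>2 * V) = \<epsilon>"
        using \<open>C > 0\<close> by (simp add: \<epsilon>_def real_sqrt_mult)
      moreover have "exp (- a\<^sup>2 / 2) = \<delta> / 2"
        using \<open>0 < ln (2 / \<delta>)\<close> assms by (simp add: a_def exp_minus)
      ultimately show ?thesis
        by (simp add: E_def)
    qed
    define bad where "bad = E 1 \<union> E (-1) \<union> (\<Union>k\<in>I. B k)"
    have B_sets [measurable]: "B k \<in> events" for k
    proof -
      have "(\<lambda>\<omega>. \<Sum>j\<in>anc k. D j \<omega>) \<in> borel_measurable M"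
        using anc_I by (intro borel_measurable_sum D_meas) auto
      then show ?thesis
        unfolding B_def by measurable
    qed
    have Z_meas [measurable]: "Z \<in> borel_measurable M"
      unfolding Z_def clip_def
      by (intro borel_measurable_sum borel_measurable_times borel_measurable_max
          borel_measurable_min borel_measurable_const D_meas P_meas)
    have E_sets [measurable]: "E r \<in> events" for r
      unfolding E_def by measurable
    have bad_sets [measurable]: "bad \<in> events"
      unfolding bad_def by measurable
    have "prob bad \<le> prob (E 1 \<union> E (-1)) + prob (\<Union>k\<in>I. B k)"
      unfolding bad_def by (intro measure_Un_le) auto
    also have "\<dots> \<le> (prob (E 1) + prob (E (-1))) + (\<Sum>k\<in>I. prob (B k))"
      by (intro add_mono measure_Un_le measure_UNION_le) auto
    also have "\<dots> \<le> (\<delta> / 2 + \<delta> / 2) + (\<Sum>k\<in>I. \<eta> / (2 * real n))"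
      by (intro add_mono sum_mono E_prob B_prob) auto
    also have "\<dots> \<le> \<delta> + \<eta>"
      using assms by (simp add: of_nat_diff field_simps)
    finally have bad_prob: "prob bad \<le> \<delta> + \<eta>" .
    have "AE \<omega> in M. \<forall>k\<in>I. \<bar>D k \<omega>\<bar> \<le> u"
      using bound by (intro AE_finite_allI) auto
    then have "AE \<omega> in M. \<omega> \<in> space M - bad \<longrightarrow> \<omega> \<in> good"
    proof eventually_elim
      case (elim \<omega>)
      show ?case
      proof
        assume \<omega>: "\<omega> \<in> space M - bad"
        have "clip (P k (\<lambda>j. D j \<omega>)) = P k (\<lambda>j. D j \<omega>)" if "k \<in> I" for k
        proof -
          have pos: "0 \<le> 1 + D j \<omega>" if "j \<in> anc k" for j
            using elim anc_I that \<open>u < 1\<close> by (force simp: abs_le_iff)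
          have "P k (\<lambda>j. D j \<omega>) \<le> (\<Prod>j\<in>anc k. exp (D j \<omega>))"
            unfolding P_def using pos by (intro prod_mono) (auto simp: exp_ge_add_one_self)
          also have "\<dots> = exp (\<Sum>j\<in>anc k. D j \<omega>)"
            by (simp add: exp_sum)
          also have "\<dots> \<le> C"
            using \<omega> that by (auto simp: bad_def B_def C_def not_le mult_ac)
          finally have "P k (\<lambda>j. D j \<omega>) \<le> C" .
          moreover have "0 \<le> P k (\<lambda>j. D j \<omega>)"
            unfolding P_def using pos by (intro prod_nonneg) auto
          ultimately show ?thesis
            by (simp add: clip_def)
        qed
        then have "s_hat n \<omega> - s n = Z \<omega>"
          by (simp add: error Z_def)
        moreover have "\<bar>Z \<omega>\<bar> \<le> \<epsilon>"
          using \<omega> by (auto simp: bad_def E_def)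
        ultimately show "\<omega> \<in> good"
          using \<omega> by (simp add: good_def)
      qed
    qed
    then have "prob (space M - bad) \<le> prob good"
      by (intro finite_measure_mono_AE good_sets)
    then show ?thesis
      using bad_prob by (simp add: prob_compl)
  qed
  then show ?thesis
    by (simp add: good_def \<epsilon>_def C_def V_def a_def I_def)
qed

end
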